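(* Every nested-triangle graph with $n=3k$ vertices ($k\geq 1$) has a non-aligned planar straight-line drawing in an $n\times\left(\frac{4}{3}n-1\right)$-grid.
   Context: A nested-triangle graph with $3k$ vertices ($k\geq1$) has vertex set $\{u_i,v_i,w_i: i=1,\dots,k\}$ and edges consisting of: the triangles $\{u_i,v_i,w_i\}$ for $i=1,\dots,k$; the paths $u_1u_2\cdots u_k$, $v_1v_2\cdots v_k$, $w_1w_2\cdots w_k$; and, optionally, in each 4-cycle of the form $u_iu_{i+1}v_{i+1}v_i$, $v_iv_{i+1}w_{i+1}w_i$ or $w_iw_{i+1}u_{i+1}u_i$ ($1\leq i<k$), at most one of its two diagonals (any choice). It is considered with the planar embedding in which the triangle $\{u_1,v_1,w_1\}$ is the outer face and triangle $\{u_{i+1},v_{i+1},w_{i+1}\}$ lies inside triangle $\{u_i,v_i,w_i\}$. A $W\times H$-grid is the set of integer points $(x,y)$ with $1\leq x\leq W$, $1\leq y\leq H$. A planar straight-line drawing maps vertices to distinct points and edges to straight segments with no crossings and no edge through a non-incident vertex. It is non-aligned if no two vertices share an $x$-coordinate and no two share a $y$-coordinate. *)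

theory Defs
  imports "HOL-Analysis.Analysis"
begin

text \<open>Vertices of the nested-triangle graph with 3k vertices: (c, i) with c < 3 and 1 \<le> i \<le> k,
  where c = 0, 1, 2 stands for u, v, w respectively.\<close>

type_synonym ntvert = "nat \<times> nat"

definition nt_vertices :: "nat \<Rightarrow> ntvert set" where
  "nt_vertices k = {(c, i). c < 3 \<and> 1 \<le> i \<and> i \<le> k}"

text \<open>Diagonal choice D c i for the 4-cycle between classes c and (c+1) mod 3 at level i (1 \<le> i < k):
  None = no diagonal; Some True = edge (c,i)--((c+1) mod 3, i+1);
  Some False = edge (c,i+1)--((c+1) mod 3, i).  Edges are unordered pairs (2-element sets).\<close>

definition nt_edges :: "nat \<Rightarrow> (nat \<Rightarrow> nat \<Rightarrow> bool option) \<Rightarrow> ntvert set set" where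
  "nt_edges k D =
     {{(c, i), (c', i)} | c c' i. c < 3 \<and> c' < 3 \<and> c \<noteq> c' \<and> 1 \<le> i \<and> i \<le> k}
   \<union> {{(c, i), (c, i + 1)} | c i. c < 3 \<and> 1 \<le> i \<and> i < k}
   \<union> {{(c, i), ((c + 1) mod 3, i + 1)} | c i. c < 3 \<and> 1 \<le> i \<and> i < k \<and> D c i = Some True}
   \<union> {{(c, i + 1), ((c + 1) mod 3, i)} | c i. c < 3 \<and> 1 \<le> i \<and> i < k \<and> D c i = Some False}"

definition pt :: "('v \<Rightarrow> int \<times> int) \<Rightarrow> 'v \<Rightarrow> real \<times> real" where
  "pt p v = (real_of_int (fst (p v)), real_of_int (snd (p v)))"

definition planar_sl_drawing :: "'v set \<Rightarrow> 'v set set \<Rightarrow> ('v \<Rightarrow> int \<times> int) \<Rightarrow> bool" where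
  "planar_sl_drawing V E p \<longleftrightarrow>
     inj_on p V \<and>
     (\<forall>a b c. {a, b} \<in> E \<and> c \<in> V \<and> pt p c \<in> closed_segment (pt p a) (pt p b) \<longrightarrow> c = a \<or> c = b) \<and>
     (\<forall>a b a' b'. {a, b} \<in> E \<and> {a', b'} \<in> E \<and> {a, b} \<noteq> {a', b'} \<longrightarrow>
        closed_segment (pt p a) (pt p b) \<inter> closed_segment (pt p a') (pt p b')
          \<subseteq> pt p ` ({a, b} \<inter> {a', b'}))"

definition non_aligned :: "'v set \<Rightarrow> ('v \<Rightarrow> int \<times> int) \<Rightarrow> bool" where
  "non_aligned V p \<longleftrightarrow> inj_on (\<lambda>v. fst (p v)) V \<and> inj_on (\<lambda>v. snd (p v)) V"

definition in_grid :: "int \<Rightarrow> int \<Rightarrow> 'v set \<Rightarrow> ('v \<Rightarrow> int \<times> int) \<Rightarrow> bool" where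
  "in_grid W H V p \<longleftrightarrow> (\<forall>v\<in>V. 1 \<le> fst (p v) \<and> fst (p v) \<le> W \<and> 1 \<le> snd (p v) \<and> snd (p v) \<le> H)"

text \<open>The drawing respects the prescribed embedding: triangle i+1 lies strictly inside triangle i
  (so triangle 1 bounds the outer face).\<close>

definition nested_embedding :: "nat \<Rightarrow> (ntvert \<Rightarrow> int \<times> int) \<Rightarrow> bool" where
  "nested_embedding k p \<longleftrightarrow>
     (\<forall>i c. 1 \<le> i \<and> i < k \<and> c < 3 \<longrightarrow>
        pt p (c, i + 1) \<in> interior (convex hull {pt p (0, i), pt p (1, i), pt p (2, i)}))"

end

theory Submission
  imports Defs
begin

text \<open>
  Place \<open>u\<^sub>i = (i, i)\<close>, \<open>v\<^sub>i = (3k+1-i, k+i)\<close> and \<open>w\<^sub>i = (k+i, 4k+1-2i)\<close>. The columns used are exactly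
  \<open>1, \<dots>, 3k\<close>, and \<open>u\<close>, \<open>v\<close>, \<open>w\<close> occupy disjoint ranges of rows up to \<open>4k-1\<close>. The triangles are
  strictly nested, and each quadrilateral between consecutive triangles is strictly convex, so either
  of its diagonals may be drawn, with a single exception: \<open>v\<^sub>k\<^sub>-\<^sub>1\<close> lies on the line through \<open>v\<^sub>k\<close> and
  \<open>w\<^sub>k\<close>, which rules out the diagonal from \<open>w\<^sub>k\<close> to \<open>v\<^sub>k\<^sub>-\<^sub>1\<close>. The roles of \<open>v\<close> and \<open>w\<close> are therefore
  assigned to classes \<open>0\<close> and \<open>1\<close> according to the last diagonal chosen between these classes; one of
  the two assignments needs a reflection of the picture to keep the triangles counterclockwise.
\<close>

section \<open>Class indices modulo 3\<close>

lemma mod3_shift: "(c + 1) mod 3 = (if c mod 3 = 2 then 0 else c mod 3 + 1)"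
  "(c + 2) mod 3 = (if c mod 3 = 0 then 2 else c mod 3 - 1)" for c :: nat
  by (auto simp: mod_Suc)

lemma mod3_cases:
  fixes c d :: nat
  obtains "d mod 3 = c mod 3" | "d mod 3 = (c + 1) mod 3" | "d mod 3 = (c + 2) mod 3"
proof -
  have "d mod 3 < 3" "c mod 3 < 3" by simp_all
  then have "d mod 3 = c mod 3 \<or> d mod 3 = (c + 1) mod 3 \<or> d mod 3 = (c + 2) mod 3"
    unfolding mod3_shift by (simp split: if_splits) arith
  then show thesis using that by blast
qed

lemma mod3_step:
  fixes c d :: nat
  shows "d mod 3 = c mod 3 \<Longrightarrow> (d + 1) mod 3 = (c + 1) mod 3"
    and "d mod 3 = (c + 1) mod 3 \<Longrightarrow> (d + 1) mod 3 = (c + 2) mod 3"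
    and "d mod 3 = (c + 2) mod 3 \<Longrightarrow> (d + 1) mod 3 = c mod 3"
  unfolding mod3_shift by (auto split: if_splits)

section \<open>Orientation determinants and segments that meet only in common ends\<close>

text \<open>Twice the signed area of the triangle \<open>a b c\<close>: positive iff
  \<open>c\<close> lies strictly to the left of the directed line from \<open>a\<close> to
  \<open>b\<close>.\<close>

definition orient :: "real \<times> real \<Rightarrow> real \<times> real \<Rightarrow> real \<times> real \<Rightarrow> real" where
  "orient a b c = (fst b - fst a) * (snd c - snd a) - (snd b - snd a) * (fst c - fst a)"

lemma orient_rotate: "orient b c a = orient a b c"
  by (simp add: orient_def algebra_simps)

lemma orient_flip: "orient b a c = - orient a b c"
  by (simp add: orient_def algebra_simps)

lemma orient_swap: "orient a c b = - orient a b c"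
  by (simp add: orient_def algebra_simps)

lemma orient_same [simp]: "orient a b a = 0" "orient a b b = 0" "orient a a b = 0"
  by (simp_all add: orient_def algebra_simps)

lemma orient_segment:
  "orient p q ((1 - t) *\<^sub>R a + t *\<^sub>R b) = (1 - t) * orient p q a + t * orient p q b"
  by (simp add: orient_def algebra_simps)

text \<open>Along the segment the determinant is affine. Before the parameter reaches 1 the
  contribution of \<open>a\<close> is nonzero and that of \<open>b\<close> has no opposite sign, so
  nothing cancels it.\<close>

lemma orient_zero_on_segment:
  assumes "x \<in> closed_segment a b" "orient p q x = 0"
    and "orient p q a > 0 \<and> orient p q b \<ge> 0 \<or> orient p q a < 0 \<and> orient p q b \<le> 0"
  shows "x = b \<and> orient p q b = 0"
proof -
  obtain t where t: "0 \<le> t" "t \<le> 1" "x = (1 - t) *\<^sub>R a + t *\<^sub>R b"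
    using assms(1) by (auto simp: closed_segment_def)
  have z: "(1 - t) * orient p q a + t * orient p q b = 0"
    using assms(2) by (simp add: t(3) orient_segment)
  have "t = 1"
  proof (rule ccontr)
    assume "t \<noteq> 1"
    then have s: "1 - t > 0" using t(2) by simp
    from assms(3) show False
    proof
      assume h: "orient p q a > 0 \<and> orient p q b \<ge> 0"
      then have "(1 - t) * orient p q a > 0" "t * orient p q b \<ge> 0" using s t(1) by simp_all
      then show False using z by simp
    next
      assume h: "orient p q a < 0 \<and> orient p q b \<le> 0"
      then have "(1 - t) * orient p q a < 0" "t * orient p q b \<le> 0"
        using s t(1) by (simp_all add: mult_pos_neg mult_nonneg_nonpos)
      then show False using z by simp
    qed
  qed
  then show ?thesis using t(3) z by simp
qed

text \<open>Phrased with points so that segments with a common end are covered as well. It fails for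
  two copies of one nondegenerate segment, hence the alternative \<open>{x, y} = {x', y'}\<close> in
  later lemmas.\<close>

definition meet_at_ends :: "real \<times> real \<Rightarrow> real \<times> real \<Rightarrow> real \<times> real \<Rightarrow> real \<times> real \<Rightarrow> bool" where
  "meet_at_ends a b c d \<longleftrightarrow> closed_segment a b \<inter> closed_segment c d \<subseteq> {a, b} \<inter> {c, d}"

lemma meet_at_ends_sym: "meet_at_ends a b c d \<Longrightarrow> meet_at_ends c d a b"
  by (auto simp: meet_at_ends_def)

lemma meet_at_ends_flip1: "meet_at_ends b a c d \<longleftrightarrow> meet_at_ends a b c d"
  unfolding meet_at_ends_def by (simp add: closed_segment_commute insert_commute)

lemma meet_at_ends_flip2: "meet_at_ends a b d c \<longleftrightarrow> meet_at_ends a b c d"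
  unfolding meet_at_ends_def by (simp add: closed_segment_commute insert_commute)

lemma orient_segment_ge: "x \<in> closed_segment a b \<Longrightarrow> orient p q a \<ge> 0 \<Longrightarrow> orient p q b \<ge> 0 \<Longrightarrow> orient p q x \<ge> 0"
  by (auto simp: closed_segment_def orient_segment)

lemma orient_segment_le: "x \<in> closed_segment a b \<Longrightarrow> orient p q a \<le> 0 \<Longrightarrow> orient p q b \<le> 0 \<Longrightarrow> orient p q x \<le> 0"
  using orient_segment_ge[of x a b q p] by (simp add: orient_flip[of q p])

text \<open>The line \<open>p q\<close> separates the segments, and the first one can touch it only
  in \<open>b\<close>. The second may lie entirely on the line; this is why \<open>b\<close> must be
  one of its ends or off the line.\<close>

lemma separated_shared:
  assumes "orient p q a > 0" "orient p q b \<ge> 0" "orient p q c \<le> 0" "orient p q d \<le> 0"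
    and "b \<in> {c, d} \<or> orient p q b > 0"
  shows "meet_at_ends a b c d"
  unfolding meet_at_ends_def
proof
  fix x assume x: "x \<in> closed_segment a b \<inter> closed_segment c d"
  then have "orient p q x = 0"
    using orient_segment_ge[of x a b p q] orient_segment_le[of x c d p q] assms by force
  then show "x \<in> {a, b} \<inter> {c, d}"
    using orient_zero_on_segment[of x a b p q] x assms by auto
qed

text \<open>Here neither segment is contained in the separating line, so each touches it only in an
  end, and a common point is an end of both.\<close>

lemma separated:
  assumes ge: "orient p q a \<ge> 0" "orient p q b \<ge> 0" and le: "orient p q c \<le> 0" "orient p q d \<le> 0"
    and "orient p q a > 0 \<or> orient p q b > 0" "orient p q c < 0 \<or> orient p q d < 0"
  shows "meet_at_ends a b c d"
  unfolding meet_at_ends_def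
proof
  fix x assume x: "x \<in> closed_segment a b \<inter> closed_segment c d"
  then have 0: "orient p q x = 0"
    using orient_segment_ge[of x a b p q] orient_segment_le[of x c d p q] ge le by force
  have "x = a \<or> x = b"
    using orient_zero_on_segment[of x a b p q] orient_zero_on_segment[of x b a p q] x 0 assms
    by (auto simp: closed_segment_commute)
  moreover have "x = c \<or> x = d"
    using orient_zero_on_segment[of x c d p q] orient_zero_on_segment[of x d c p q] x 0 assms
    by (auto simp: closed_segment_commute)
  ultimately show "x \<in> {a, b} \<inter> {c, d}" by auto
qed

text \<open>The separating line is the line of \<open>a b\<close> itself, directed so that
  \<open>c\<close> is on its left.\<close>

lemma meet_at_hinge:
  assumes "orient a b c \<noteq> 0"
  shows "meet_at_ends a b a c"
proof -
  have "meet_at_ends c a a b"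
  proof (cases "orient a b c > 0")
    case True
    then show ?thesis by (intro separated_shared[of a b]) auto
  next
    case False
    then have "orient b a c > 0" using assms by (simp add: orient_flip[of b a])
    then show ?thesis by (intro separated_shared[of b a]) auto
  qed
  then show ?thesis using meet_at_ends_sym meet_at_ends_flip1 meet_at_ends_flip2 by blast
qed

lemma meet_at_hinge_rotated:
  assumes "orient a b c \<noteq> 0"
  shows "meet_at_ends a b b c" "meet_at_ends a b c a" "meet_at_ends a b c b"
  using meet_at_hinge[of b a c] meet_at_hinge[of a b c] assms
  by (simp_all add: orient_flip[of b] meet_at_ends_flip1[of b] meet_at_ends_flip2[of _ _ c])

text \<open>Three open half-planes intersect in an open set, and it lies in the hull because the
  three determinants are barycentric coordinates up to scaling.\<close>

lemma positive_orient_in_interior: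
  assumes "orient a b x > 0" "orient b c x > 0" "orient c a x > 0"
  shows "x \<in> interior (convex hull {a, b, c})"
proof -
  let ?S = "{x. orient a b x > 0 \<and> orient b c x > 0 \<and> orient c a x > 0}"
  have "open ?S"
    unfolding orient_def by (intro open_Collect_conj open_Collect_less continuous_intros)
  moreover have "?S \<subseteq> convex hull {a, b, c}"
  proof
    fix y assume "y \<in> ?S"
    define s where "s = orient a b y + orient b c y + orient c a y"
    have s: "s > 0" using \<open>y \<in> ?S\<close> by (simp add: s_def)
    let ?u = "orient b c y / s" and ?v = "orient c a y / s" and ?w = "orient a b y / s"
    \<comment> \<open>The barycentric identity: the weight of each corner is the area spanned by
      \<open>y\<close> and the opposite side.\<close>
    have "s *\<^sub>R y = orient b c y *\<^sub>R a + orient c a y *\<^sub>R b + orient a b y *\<^sub>R c"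
      by (simp add: s_def orient_def prod_eq_iff algebra_simps)
    then have "(1/s) *\<^sub>R s *\<^sub>R y = (1/s) *\<^sub>R (orient b c y *\<^sub>R a + orient c a y *\<^sub>R b + orient a b y *\<^sub>R c)"
      by simp
    then have "y = ?u *\<^sub>R a + ?v *\<^sub>R b + ?w *\<^sub>R c"
      using s by (simp add: scaleR_add_right)
    moreover have "?u + ?v + ?w = 1"
      using s by (simp add: s_def add_divide_distrib[symmetric])
    moreover have "?u \<ge> 0" "?v \<ge> 0" "?w \<ge> 0" using s \<open>y \<in> ?S\<close> by auto
    ultimately show "y \<in> convex hull {a, b, c}"
      unfolding convex_hull_3 by blast
  qed
  ultimately have "?S \<subseteq> interior (convex hull {a, b, c})" by (rule interior_maximal[rotated])
  then show ?thesis using assms by blast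
qed

section \<open>Planarity of abstract nested triangles\<close>

locale nested_triangles =
  fixes k :: nat and D :: "nat \<Rightarrow> nat \<Rightarrow> bool option" and Q :: "nat \<Rightarrow> nat \<Rightarrow> real \<times> real"
  \<comment> \<open>\<open>Q c i\<close> is the corner of class \<open>c mod 3\<close> at level \<open>i\<close>; the triangles are counterclockwise.
    The corners of level \<open>i\<close> lie weakly outside the facing sides at level \<open>i + 1\<close>, strictly where
    an edge between the levels needs it.\<close>
  assumes period: "Q (c mod 3) i = Q c i"
    and triangle: "1 \<le> i \<Longrightarrow> i \<le> k \<Longrightarrow> orient (Q c i) (Q (c + 1) i) (Q (c + 2) i) > 0"
    and inside: "1 \<le> i \<Longrightarrow> i < j \<Longrightarrow> j \<le> k \<Longrightarrow> orient (Q c i) (Q (c + 1) i) (Q d j) > 0"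
    and beyond_left: "1 \<le> i \<Longrightarrow> i < k \<Longrightarrow> orient (Q c (i + 1)) (Q (c + 1) (i + 1)) (Q c i) \<le> 0"
    and beyond_right: "1 \<le> i \<Longrightarrow> i < k \<Longrightarrow> orient (Q c (i + 1)) (Q (c + 1) (i + 1)) (Q (c + 1) i) \<le> 0"
    and strict_left: "1 \<le> i \<Longrightarrow> i < k \<Longrightarrow> D (c mod 3) i = Some True \<Longrightarrow>
       orient (Q c (i + 1)) (Q (c + 1) (i + 1)) (Q c i) < 0"
    and strict_right: "1 \<le> i \<Longrightarrow> i < k \<Longrightarrow> D (c mod 3) i = Some False \<Longrightarrow>
       orient (Q c (i + 1)) (Q (c + 1) (i + 1)) (Q (c + 1) i) < 0"
    and strict_quad: "1 \<le> i \<Longrightarrow> i < k \<Longrightarrow>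
       orient (Q c (i + 1)) (Q (c + 1) (i + 1)) (Q c i) < 0 \<or>
       orient (Q c (i + 1)) (Q (c + 1) (i + 1)) (Q (c + 1) i) < 0"
    and strict_corner: "1 \<le> i \<Longrightarrow> i < k \<Longrightarrow>
       orient (Q c (i + 1)) (Q (c + 1) (i + 1)) (Q c i) < 0 \<or>
       orient (Q (c + 2) (i + 1)) (Q c (i + 1)) (Q c i) < 0"
begin

lemma Q_cong: "c mod 3 = d mod 3 \<Longrightarrow> Q c i = Q d i"
  using period[of c i] period[of d i] by simp

text \<open>Sides are directed counterclockwise, so the triangle lies to their left.\<close>

definition side :: "nat \<Rightarrow> real \<times> real \<Rightarrow> real \<times> real \<Rightarrow> bool" where
  "side i x y \<longleftrightarrow> (\<exists>c. x = Q c i \<and> y = Q (c + 1) i)"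

text \<open>The outer end comes first. Of the two spokes bounding the quadrilateral only that of
  class \<open>c\<close> is included, so each spoke is assigned to one quadrilateral.\<close>

definition quad_link :: "nat \<Rightarrow> nat \<Rightarrow> real \<times> real \<Rightarrow> real \<times> real \<Rightarrow> bool" where
  "quad_link c i x y \<longleftrightarrow>
     x = Q c i \<and> y = Q c (i + 1) \<or>
     x = Q c i \<and> y = Q (c + 1) (i + 1) \<and> D (c mod 3) i = Some True \<or>
     x = Q (c + 1) i \<and> y = Q c (i + 1) \<and> D (c mod 3) i = Some False"

definition link :: "nat \<Rightarrow> real \<times> real \<Rightarrow> real \<times> real \<Rightarrow> bool" where
  "link i x y \<longleftrightarrow> (\<exists>c. quad_link c i x y)"

lemma quad_link_cong: "c mod 3 = d mod 3 \<Longrightarrow> quad_link c i x y \<longleftrightarrow> quad_link d i x y"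
  using Q_cong[of c d] Q_cong[OF mod3_step(1)[of c d]] by (simp add: quad_link_def)

lemma corner_cases: "\<exists>d. Q e i = Q d i \<and> (d = c \<or> d = c + 1 \<or> d = c + 2)"
  by (rule mod3_cases[of e c]) (use Q_cong in blast)+

lemma triangle_ge: "1 \<le> i \<Longrightarrow> i \<le> k \<Longrightarrow> orient (Q c i) (Q (c + 1) i) (Q d i) \<ge> 0"
  using corner_cases[of d i c] triangle[of i c] by force

lemma inside_ge: "1 \<le> i \<Longrightarrow> i \<le> j \<Longrightarrow> j \<le> k \<Longrightarrow> orient (Q c i) (Q (c + 1) i) (Q d j) \<ge> 0"
  using triangle_ge[of i c d] inside[of i j c d] by (cases "i = j") auto

lemma side_end: "side i x y \<Longrightarrow> \<exists>c d. x = Q c i \<and> y = Q d i"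
  by (auto simp: side_def)

lemma link_end: "link i x y \<Longrightarrow> \<exists>c d. x = Q c i \<and> y = Q d (i + 1)"
  by (auto simp: link_def quad_link_def)

text \<open>Provides a line separating a link from everything inside triangle \<open>i + 1\<close>.
  A diagonal uses the inner side of its own quadrilateral; a spoke may use either inner side at its
  corner, and \<open>strict_corner\<close> guarantees that one of them works.\<close>

lemma link_separator:
  assumes "link i x y" "1 \<le> i" "i < k"
  shows "\<exists>c. y \<in> {Q c (i + 1), Q (c + 1) (i + 1)} \<and>
     orient (Q c (i + 1)) (Q (c + 1) (i + 1)) x < 0"
proof -
  from assms(1) obtain c where
    "x = Q c i \<and> y = Q c (i + 1) \<or>
     x = Q c i \<and> y = Q (c + 1) (i + 1) \<and> D (c mod 3) i = Some True \<or>
     x = Q (c + 1) i \<and> y = Q c (i + 1) \<and> D (c mod 3) i = Some False"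
    unfolding link_def quad_link_def by blast
  then consider "x = Q c i" "y = Q c (i + 1)"
    | "x = Q c i" "y = Q (c + 1) (i + 1)" "D (c mod 3) i = Some True"
    | "x = Q (c + 1) i" "y = Q c (i + 1)" "D (c mod 3) i = Some False"
    by blast
  then show ?thesis
  proof cases
    case 1
    \<comment> \<open>The other side at the corner starts in class \<open>c + 2\<close> and ends in
      class \<open>c + 3\<close>, which is \<open>c\<close> again.\<close>
    have r: "Q (c + 2 + 1) (i + 1) = Q c (i + 1)" by (rule Q_cong) simp
    from strict_corner[OF assms(2,3), of c] show ?thesis
    proof
      assume "orient (Q c (i + 1)) (Q (c + 1) (i + 1)) (Q c i) < 0"
      then show ?thesis using 1 by blast
    next
      assume "orient (Q (c + 2) (i + 1)) (Q c (i + 1)) (Q c i) < 0"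
      then show ?thesis using 1 r by (intro exI[of _ "c + 2"]) (simp only: insert_iff simp_thms)
    qed
  next
    case 2
    then show ?thesis using strict_left[OF assms(2,3)] by blast
  next
    case 3
    then show ?thesis using strict_right[OF assms(2,3)] by blast
  qed
qed

lemma side_side:
  assumes "side i x y" "side i x' y'" "1 \<le> i" "i \<le> k"
  shows "{x, y} = {x', y'} \<or> meet_at_ends x y x' y'"
proof -
  obtain c where c: "x = Q c i" "y = Q (c + 1) i" using assms(1) by (auto simp: side_def)
  obtain d where d: "x' = Q d i" "y' = Q (d + 1) i" using assms(2) by (auto simp: side_def)
  note t = triangle[OF assms(3,4), of c]
  show ?thesis
  proof (rule mod3_cases[of d c])
    assume "d mod 3 = c mod 3"
    then have "x' = x" "y' = y" unfolding c d by (blast intro: Q_cong mod3_step(1))+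
    then show ?thesis by simp
  next
    assume 2: "d mod 3 = (c + 1) mod 3"
    then have "x' = Q (c + 1) i" unfolding d by (rule Q_cong)
    moreover have "(d + 1) mod 3 = (c + 2) mod 3" using 2 by (rule mod3_step)
    then have "y' = Q (c + 2) i" unfolding d by (rule Q_cong)
    ultimately show ?thesis using t c by (auto intro!: meet_at_hinge_rotated)
  next
    assume 3: "d mod 3 = (c + 2) mod 3"
    then have "x' = Q (c + 2) i" unfolding d by (rule Q_cong)
    moreover have "(d + 1) mod 3 = c mod 3" using 3 by (rule mod3_step)
    then have "y' = Q c i" unfolding d by (rule Q_cong)
    ultimately show ?thesis using t c by (auto intro!: meet_at_hinge_rotated)
  qed
qed

text \<open>The link ends strictly to the left of the side and starts either in an end of it or
  strictly to the left as well.\<close>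

lemma side_link:
  assumes "side i x y" "link i x' y'" "1 \<le> i" "i < k"
  shows "meet_at_ends x y x' y'"
proof -
  obtain c where c: "x = Q c i" "y = Q (c + 1) i" using assms(1) by (auto simp: side_def)
  obtain d e where d: "x' = Q d i" "y' = Q e (i + 1)" using link_end[OF assms(2)] by auto
  have "orient x y y' > 0" using inside[of i "i + 1" c e] assms(3,4) c d by simp
  moreover have "x' \<in> {x, y} \<or> orient x y x' > 0"
    using corner_cases[of d i c] triangle[of i c] assms(3,4) c d by force
  ultimately have "meet_at_ends y' x' x y" by (intro separated_shared[of x y]) auto
  then show ?thesis using meet_at_ends_sym meet_at_ends_flip1 by blast
qed

text \<open>All corners of deeper levels lie strictly to the left of the side.\<close>

lemma side_inner:
  assumes "side i x y" "1 \<le> i" "i < j" "side j x' y' \<and> j \<le> k \<or> link j x' y' \<and> j < k"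
  shows "meet_at_ends x y x' y'"
proof -
  obtain c where c: "x = Q c i" "y = Q (c + 1) i" using assms(1) by (auto simp: side_def)
  obtain d e j' where d: "x' = Q d j" "y' = Q e j'" "j \<le> j'" "j' \<le> k"
    using assms(4) side_end[of j x' y'] link_end[of j x' y'] by fastforce
  have "orient x y x' > 0" "orient x y y' > 0"
    using inside[of i j c d] inside[of i j' c e] assms(2,3) c d by auto
  then have "meet_at_ends x' y' x y" by (intro separated_shared[of x y]) auto
  then show ?thesis by (rule meet_at_ends_sym)
qed

text \<open>The line from \<open>link_separator\<close> has the link on its outer side, touching it
  only in \<open>y\<close>, and all deeper corners on the line or on its inner side.\<close>

lemma link_inner:
  assumes "link i x y" "1 \<le> i" "i < j" "side j x' y' \<and> j \<le> k \<or> link j x' y' \<and> j < k"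
  shows "meet_at_ends x y x' y'"
proof -
  have "i < k" using assms(3,4) by auto
  then obtain c where c: "y \<in> {Q c (i + 1), Q (c + 1) (i + 1)}"
      "orient (Q c (i + 1)) (Q (c + 1) (i + 1)) x < 0"
    using link_separator[OF assms(1,2)] by blast
  let ?p = "Q c (i + 1)" and ?q = "Q (c + 1) (i + 1)"
  \<comment> \<open>The line is reversed so that the link is on the positive side, as the separation
    lemmas require.\<close>
  have x: "orient ?q ?p x > 0" using c(2) orient_flip[of ?q ?p x] by linarith
  have y: "orient ?q ?p y = 0" using c(1) by auto
  obtain d e j' where d: "x' = Q d j" "y' = Q e j'" "j \<le> j'" "j' \<le> k"
    using assms(4) side_end[of j x' y'] link_end[of j x' y'] by fastforce
  have "orient ?p ?q x' \<ge> 0" "orient ?p ?q y' \<ge> 0"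
    using inside_ge[of "i + 1" j c d] inside_ge[of "i + 1" j' c e] assms(2,3) d by auto
  then have le: "orient ?q ?p x' \<le> 0" "orient ?q ?p y' \<le> 0" using orient_flip[of ?q ?p x'] orient_flip[of ?q ?p y'] by linarith+
  \<comment> \<open>Both ends of the inner segment can be on the line only if it is the separating
    side itself, which has \<open>y\<close> as an end. Any other side of triangle
    \<open>i + 1\<close> contains the third corner, and a link or deeper side has an end strictly
    inside.\<close>
  have "y \<in> {x', y'} \<or> orient ?p ?q x' > 0 \<or> orient ?p ?q y' > 0"
  proof (cases "j = i + 1 \<and> side j x' y'")
    case True
    then obtain a where a: "x' = Q a (i + 1)" "y' = Q (a + 1) (i + 1)" by (auto simp: side_def)
    have t: "orient ?p ?q (Q (c + 2) (i + 1)) > 0" using triangle[of "i + 1" c] \<open>i < k\<close> by simp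
    consider "a mod 3 = c mod 3" | "a mod 3 = (c + 2) mod 3" | "(a + 1) mod 3 = (c + 2) mod 3"
      using mod3_cases[of a c] mod3_step(2)[of a c] by blast
    then show ?thesis
    proof cases
      case 1
      then have "x' = ?p" "y' = ?q" unfolding a by (blast intro: Q_cong mod3_step(1))+
      then show ?thesis using c(1) by blast
    next
      case 2
      then have "x' = Q (c + 2) (i + 1)" unfolding a by (rule Q_cong)
      then show ?thesis using t by simp
    next
      case 3
      then have "y' = Q (c + 2) (i + 1)" unfolding a by (rule Q_cong)
      then show ?thesis using t by simp
    qed
  next
    case False
    then have "j > i + 1 \<or> link j x' y' \<and> j < k" using assms(3,4) by (cases "j = i + 1") auto
    then show ?thesis
    proof
      assume "j > i + 1"
      then show ?thesis using inside[of "i + 1" j c d] d by auto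
    next
      assume l: "link j x' y' \<and> j < k"
      then obtain e' where "y' = Q e' (j + 1)" using link_end by blast
      then show ?thesis using inside[of "i + 1" "j + 1" c e'] l assms(3) by auto
    qed
  qed
  then consider "y \<in> {x', y'}" | "orient ?q ?p x' < 0 \<or> orient ?q ?p y' < 0"
    using orient_flip[of ?q ?p x'] orient_flip[of ?q ?p y'] by linarith
  then show ?thesis
  proof cases
    case 1
    then show ?thesis using x y le by (intro separated_shared[of ?q ?p]) auto
  next
    case 2
    then show ?thesis using x y le by (intro separated[of ?q ?p]) auto
  qed
qed

text \<open>Since \<open>D\<close> selects at most one diagonal, distinct links are the spoke and
  that diagonal. They share the outer end for a rising diagonal and the inner end for a falling one,
  and are not collinear.\<close>

lemma quad_link_same:
  assumes "quad_link c i x y" "quad_link c i x' y'" "1 \<le> i" "i < k"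
  shows "{x, y} = {x', y'} \<or> meet_at_ends x y x' y'"
proof -
  let ?A = "Q c i" and ?A1 = "Q (c + 1) i" and ?B = "Q c (i + 1)" and ?B1 = "Q (c + 1) (i + 1)"
  have "D (c mod 3) i = Some True \<Longrightarrow> orient ?A ?B ?B1 \<noteq> 0"
    using strict_left[OF assms(3,4), of c] orient_rotate[of ?B ?B1 ?A] by linarith
  then have T: "D (c mod 3) i = Some True \<Longrightarrow> meet_at_ends ?A ?B ?A ?B1"
    by (rule meet_at_hinge)
  have "orient ?A ?B ?A1 \<noteq> 0"
    using inside[of i "i + 1" c c] assms(3,4) orient_swap[of ?A ?B ?A1] by linarith
  then have F: "meet_at_ends ?A ?B ?A1 ?B"
    by (rule meet_at_hinge_rotated)
  show ?thesis
    using assms(1,2) T F unfolding quad_link_def by (auto intro: meet_at_ends_sym)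
qed

text \<open>The line of the common spoke from \<open>?A1\<close> to \<open>?B1\<close> has the links
  of quadrilateral \<open>c\<close> weakly on its left and those of \<open>c + 1\<close> weakly on
  its right.\<close>

lemma quad_link_adjacent:
  assumes "quad_link c i x y" "quad_link (c + 1) i x' y'" "1 \<le> i" "i < k"
  shows "meet_at_ends x y x' y'"
proof -
  let ?A = "Q c i" and ?A1 = "Q (c + 1) i" and ?A2 = "Q (c + 2) i"
  let ?B = "Q c (i + 1)" and ?B1 = "Q (c + 1) (i + 1)" and ?B2 = "Q (c + 2) (i + 1)"
  have A: "orient ?A1 ?B1 ?A > 0"
    using inside[of i "i + 1" c "c + 1"] assms(3,4) orient_rotate[of ?A1 ?B1 ?A] by linarith
  have A2: "orient ?A1 ?B1 ?A2 < 0"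
    using inside[of i "i + 1" "c + 1" "c + 1"] assms(3,4) orient_swap[of ?A1 ?A2 ?B1] by simp
  have rot: "orient ?A1 ?B1 ?B = - orient ?B ?B1 ?A1" "orient ?A1 ?B1 ?B2 = orient ?B1 ?B2 ?A1"
    by (simp_all add: orient_def algebra_simps)
  have B: "orient ?A1 ?B1 ?B \<ge> 0" "D (c mod 3) i = Some False \<Longrightarrow> orient ?A1 ?B1 ?B > 0"
    using beyond_right[OF assms(3,4), of c] strict_right[OF assms(3,4), of c] rot by simp_all
  have B2: "orient ?A1 ?B1 ?B2 \<le> 0" "D ((c + 1) mod 3) i = Some True \<Longrightarrow> orient ?A1 ?B1 ?B2 < 0"
    using beyond_left[OF assms(3,4), of "c + 1"] strict_left[OF assms(3,4), of "c + 1"] rot by simp_all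
  have x: "orient ?A1 ?B1 x \<ge> 0" "orient ?A1 ?B1 y \<ge> 0"
    and x': "orient ?A1 ?B1 x' \<le> 0" "orient ?A1 ?B1 y' \<le> 0"
    using assms(1,2) A A2 B B2 unfolding quad_link_def by auto
  have pos: "orient ?A1 ?B1 x > 0 \<or> orient ?A1 ?B1 y > 0"
    using assms(1) A B unfolding quad_link_def by auto
  show ?thesis
  proof (cases "x' = ?A1 \<and> y' = ?B1")
    case False
    then have "orient ?A1 ?B1 x' < 0 \<or> orient ?A1 ?B1 y' < 0"
      using assms(2) A2 B2 unfolding quad_link_def by auto
    then show ?thesis using separated x x' pos by blast
  next
    case True
    from assms(1) consider "x = ?A" "y = ?B" | "x = ?A" "y = ?B1"
      | "x = ?A1" "y = ?B" "D (c mod 3) i = Some False"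
      unfolding quad_link_def by blast
    then show ?thesis
    proof cases
      case 1
      show ?thesis
      proof (cases "orient ?A1 ?B1 ?B > 0")
        case True': True
        then show ?thesis using 1 x x' A by (intro separated_shared[of ?A1 ?B1]) auto
      next
        case False
        \<comment> \<open>Degenerate case: \<open>?B\<close> lies on the line of the common spoke,
          so that line may meet both segments. The line of the diagonal from \<open>?A\<close> to
          \<open>?B1\<close> separates the two spokes instead, since by \<open>strict_quad\<close>
          the points \<open>?A\<close>, \<open>?B\<close>, \<open>?B1\<close> are not
          collinear.\<close>
        then have "orient ?B ?B1 ?A < 0" using strict_quad[OF assms(3,4), of c] rot by simp
        then have "orient ?A ?B1 ?B > 0" by (simp add: orient_def algebra_simps)
        moreover have "orient ?A ?B1 ?A1 < 0" using A by (simp add: orient_def algebra_simps)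
        ultimately show ?thesis using 1 True by (intro separated[of ?A ?B1]) auto
      qed
    next
      case 2
      then show ?thesis using A True by (intro separated_shared[of ?A1 ?B1]) auto
    next
      case 3
      then have "meet_at_ends y x x' y'" using B True by (intro separated_shared[of ?A1 ?B1]) auto
      then show ?thesis by (simp add: meet_at_ends_flip1)
    qed
  qed
qed

text \<open>With three classes, any two quadrilaterals between the same levels coincide or are
  neighbours.\<close>

lemma link_link:
  assumes "link i x y" "link i x' y'" "1 \<le> i" "i < k"
  shows "{x, y} = {x', y'} \<or> meet_at_ends x y x' y'"
proof -
  obtain c d where c: "quad_link c i x y" and d: "quad_link d i x' y'"
    using assms(1,2) unfolding link_def by blast
  show ?thesis
  proof (rule mod3_cases[of d c])
    assume "d mod 3 = c mod 3"
    then show ?thesis using quad_link_same[OF c] d quad_link_cong assms(3,4) by blast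
  next
    assume "d mod 3 = (c + 1) mod 3"
    then show ?thesis using quad_link_adjacent[OF c] d quad_link_cong assms(3,4) by blast
  next
    assume "d mod 3 = (c + 2) mod 3"
    then have "c mod 3 = (d + 1) mod 3" by (rule mod3_step(3)[symmetric])
    then show ?thesis
      using quad_link_adjacent[OF d] c quad_link_cong assms(3,4) meet_at_ends_sym by blast
  qed
qed

lemma edge_edge:
  assumes "side i x y \<and> i \<le> k \<or> link i x y \<and> i < k" "side j x' y' \<and> j \<le> k \<or> link j x' y' \<and> j < k"
    and "1 \<le> i" "1 \<le> j"
  shows "{x, y} = {x', y'} \<or> meet_at_ends x y x' y'"
proof -
  consider "i < j" | "j < i" | "i = j" by linarith
  then show ?thesis
  proof cases
    case 1
    then show ?thesis using side_inner link_inner assms by blast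
  next
    case 2
    then show ?thesis using side_inner link_inner meet_at_ends_sym assms by blast
  next
    case 3
    then show ?thesis using side_side side_link link_link meet_at_ends_sym assms by blast
  qed
qed

end

section \<open>Verification of the explicit coordinates\<close>

text \<open>Unrolls the cyclic index into three named corners. Only the quadrilateral between
  classes 0 and 1 is allowed a degeneracy, so only the choices \<open>D 0 i\<close> enter the
  hypotheses.\<close>

lemma nested_triangles_cyclic:
  fixes X Y Z :: "nat \<Rightarrow> real \<times> real"
  defines "Q \<equiv> \<lambda>c i. if c mod 3 = 0 then X i else if c mod 3 = 1 then Y i else Z i"
  assumes triangle: "\<And>i. 1 \<le> i \<Longrightarrow> i \<le> k \<Longrightarrow> orient (X i) (Y i) (Z i) > 0"
    and inside: "\<And>i j p. 1 \<le> i \<Longrightarrow> i < j \<Longrightarrow> j \<le> k \<Longrightarrow> p \<in> {X j, Y j, Z j} \<Longrightarrow>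
      orient (X i) (Y i) p > 0 \<and> orient (Y i) (Z i) p > 0 \<and> orient (Z i) (X i) p > 0"
    and beyond: "\<And>i. 1 \<le> i \<Longrightarrow> i < k \<Longrightarrow>
      orient (Y (i + 1)) (Z (i + 1)) (Y i) < 0 \<and> orient (Y (i + 1)) (Z (i + 1)) (Z i) < 0 \<and>
      orient (Z (i + 1)) (X (i + 1)) (Z i) < 0 \<and> orient (Z (i + 1)) (X (i + 1)) (X i) < 0"
    and weak: "\<And>i. 1 \<le> i \<Longrightarrow> i < k \<Longrightarrow>
      orient (X (i + 1)) (Y (i + 1)) (X i) \<le> 0 \<and> orient (X (i + 1)) (Y (i + 1)) (Y i) \<le> 0 \<and>
      (orient (X (i + 1)) (Y (i + 1)) (X i) < 0 \<or> orient (X (i + 1)) (Y (i + 1)) (Y i) < 0)"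
    and diagonal: "\<And>i. 1 \<le> i \<Longrightarrow> i < k \<Longrightarrow> D 0 i = Some True \<Longrightarrow>
      orient (X (i + 1)) (Y (i + 1)) (X i) < 0"
      "\<And>i. 1 \<le> i \<Longrightarrow> i < k \<Longrightarrow> D 0 i = Some False \<Longrightarrow>
      orient (X (i + 1)) (Y (i + 1)) (Y i) < 0"
  shows "nested_triangles k D Q"
proof -
  have Q: "c mod 3 = 0 \<and> (\<forall>i. Q c i = X i \<and> Q (c + 1) i = Y i \<and> Q (c + 2) i = Z i) \<or>
      c mod 3 = 1 \<and> (\<forall>i. Q c i = Y i \<and> Q (c + 1) i = Z i \<and> Q (c + 2) i = X i) \<or>
      c mod 3 = 2 \<and> (\<forall>i. Q c i = Z i \<and> Q (c + 1) i = X i \<and> Q (c + 2) i = Y i)" for c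
  proof -
    have "c mod 3 = 0 \<or> c mod 3 = 1 \<or> c mod 3 = 2" by linarith
    then show ?thesis unfolding Q_def mod3_shift by auto
  qed
  show ?thesis
  proof
    fix c i show "Q (c mod 3) i = Q c i" by (simp add: Q_def)
  next
    fix i c :: nat assume i: "1 \<le> i" "i \<le> k"
    show "orient (Q c i) (Q (c + 1) i) (Q (c + 2) i) > 0"
      using Q[of c] triangle[OF i] orient_rotate[of "X i" "Y i" "Z i"] orient_rotate[of "Y i" "Z i" "X i"]
      by (elim disjE conjE) (simp_all only:)
  next
    fix i j c d :: nat assume i: "1 \<le> i" "i < j" "j \<le> k"
    have "Q d j \<in> {X j, Y j, Z j}" by (simp add: Q_def)
    from inside[OF i this] show "orient (Q c i) (Q (c + 1) i) (Q d j) > 0"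
      using Q[of c] by (elim disjE conjE) (simp_all only:)
  next
    fix i c :: nat assume i: "1 \<le> i" "i < k"
    note facts = Q[of c] beyond[OF i] weak[OF i] diagonal[OF i]
    show "orient (Q c (i + 1)) (Q (c + 1) (i + 1)) (Q c i) \<le> 0"
      "orient (Q c (i + 1)) (Q (c + 1) (i + 1)) (Q (c + 1) i) \<le> 0"
      "orient (Q c (i + 1)) (Q (c + 1) (i + 1)) (Q c i) < 0 \<or>
       orient (Q c (i + 1)) (Q (c + 1) (i + 1)) (Q (c + 1) i) < 0"
      "orient (Q c (i + 1)) (Q (c + 1) (i + 1)) (Q c i) < 0 \<or>
       orient (Q (c + 2) (i + 1)) (Q c (i + 1)) (Q c i) < 0"
      using facts(1-3) by (elim disjE conjE; simp only: simp_thms less_imp_le)+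
    show "orient (Q c (i + 1)) (Q (c + 1) (i + 1)) (Q c i) < 0" if "D (c mod 3) i = Some True"
      using facts that by (elim disjE conjE; simp only: simp_thms)
    show "orient (Q c (i + 1)) (Q (c + 1) (i + 1)) (Q (c + 1) i) < 0" if "D (c mod 3) i = Some False"
      using facts that by (elim disjE conjE; simp only: simp_thms)
  qed
qed

lemma corners_inside:
  fixes n i j :: real
  assumes "1 \<le> i" "i + 1 \<le> j" "j \<le> n"
  defines "low \<equiv> \<lambda>i. (i, i)" and "right \<equiv> \<lambda>i. (3 * n + 1 - i, n + i)"
    and "apex \<equiv> \<lambda>i. (n + i, 4 * n + 1 - 2 * i)"
  assumes C: "c \<in> {low j, right j, apex j}"
  shows "orient (low i) (right i) c > 0" "orient (right i) (apex i) c > 0" "orient (apex i) (low i) c > 0"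
proof -
  \<comment> \<open>In terms of the slacks of the hypotheses, each determinant is a polynomial with nonnegative
    coefficients and positive constant term.\<close>
  define t d m where "t = i - 1" and "d = j - i - 1" and "m = n - j"
  have e: "i = 1 + t" "j = 2 + t + d" "n = 2 + t + d + m" by (simp_all add: t_def d_def m_def)
  have n: "t \<ge> 0" "d \<ge> 0" "m \<ge> 0" using assms(1-3) by (simp_all add: t_def d_def m_def)
  show "orient (low i) (right i) c > 0" "orient (right i) (apex i) c > 0" "orient (apex i) (low i) c > 0"
    using C n unfolding orient_def low_def right_def apex_def e
    by (auto simp: algebra_simps add_pos_nonneg add_nonneg_pos)
qed

lemma corners_oriented:
  fixes n i :: real
  assumes "1 \<le> i" "i \<le> n"
  shows "orient (3 * n + 1 - i, n + i) (n + i, 4 * n + 1 - 2 * i) (i, i) > 0"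
proof -
  \<comment> \<open>Slack variables again turn the claim into positivity of a polynomial.\<close>
  define t d where "t = i - 1" and "d = n - i"
  have e: "i = 1 + t" "n = 1 + t + d" by (simp_all add: t_def d_def)
  have n: "t \<ge> 0" "d \<ge> 0" using assms by (simp_all add: t_def d_def)
  show ?thesis
    using n unfolding orient_def e by (simp add: algebra_simps add_pos_nonneg add_nonneg_pos)
qed

text \<open>Classes 0, 1, 2 are \<open>v\<close>, \<open>w\<close>, \<open>u\<close>. The excluded
  value is the diagonal from \<open>v\<close> at level \<open>k - 1\<close> to \<open>w\<close> at
  level \<open>k\<close>, the one that the coordinates cannot accommodate.\<close>

lemma nested_straight:
  assumes "D 0 (k - 1) \<noteq> Some True"
  shows "nested_triangles k D (\<lambda>c i. if c mod 3 = 0 then (3 * real k + 1 - real i, real k + real i)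
    else if c mod 3 = 1 then (real k + real i, 4 * real k + 1 - 2 * real i) else (real i, real i))"
proof -
  let ?X = "\<lambda>i. (3 * real k + 1 - real i, real k + real i)"
  let ?Y = "\<lambda>i. (real k + real i, 4 * real k + 1 - 2 * real i)"
  let ?Z = "\<lambda>i. (real i, real i)"
  show ?thesis
  proof (rule nested_triangles_cyclic)
    fix i assume "1 \<le> i" "i \<le> k"
    then show "orient (?X i) (?Y i) (?Z i) > 0"
      by (intro corners_oriented) simp_all
  next
    fix i j p assume "1 \<le> i" "i < j" "j \<le> k"
      "p \<in> {?X j, ?Y j, ?Z j}"
    then show "orient (?X i) (?Y i) p > 0 \<and> orient (?Y i) (?Z i) p > 0 \<and> orient (?Z i) (?X i) p > 0"
      using corners_inside[of "real i" "real j" "real k" p] by auto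
  next
    fix i assume i: "1 \<le> i" "i < k"
    then have r: "real i \<ge> 1" "real i + 1 \<le> real k" by simp_all
    show "orient (?Y (i + 1)) (?Z (i + 1)) (?Y i) < 0 \<and>
        orient (?Y (i + 1)) (?Z (i + 1)) (?Z i) < 0 \<and>
        orient (?Z (i + 1)) (?X (i + 1)) (?Z i) < 0 \<and>
        orient (?Z (i + 1)) (?X (i + 1)) (?X i) < 0"
      using r by (auto simp: orient_def algebra_simps)
    show "orient (?X (i + 1)) (?Y (i + 1)) (?X i) \<le> 0 \<and>
        orient (?X (i + 1)) (?Y (i + 1)) (?Y i) \<le> 0 \<and>
        (orient (?X (i + 1)) (?Y (i + 1)) (?X i) < 0 \<or>
        orient (?X (i + 1)) (?Y (i + 1)) (?Y i) < 0)"
      using r by (auto simp: orient_def algebra_simps)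
    show "orient (?X (i + 1)) (?Y (i + 1)) (?X i) < 0" if "D 0 i = Some True"
    proof -
      \<comment> \<open>The determinant equals \<open>i + 1 - k\<close>, which vanishes exactly at
        the last step.\<close>
      have "i \<noteq> k - 1" using that assms by auto
      then have "real i + 2 \<le> real k" using i by linarith
      then show ?thesis using r by (simp add: orient_def algebra_simps)
    qed
    show "orient (?X (i + 1)) (?Y (i + 1)) (?Y i) < 0"
      using r by (simp add: orient_def algebra_simps)
  qed
qed

text \<open>Classes 0, 1, 2 are \<open>w\<close>, \<open>v\<close>, \<open>u\<close>, with the
  picture reflected by replacing \<open>x\<close> with \<open>3k + 1 - x\<close>. The excluded
  diagonal is now the falling one at level \<open>k - 1\<close>, which cannot occur as
  \<open>D\<close> selects the rising one there.\<close>

lemma nested_mirrored: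
  assumes "D 0 (k - 1) = Some True"
  shows "nested_triangles k D (\<lambda>c i. if c mod 3 = 0 then (2 * real k + 1 - real i, 4 * real k + 1 - 2 * real i)
    else if c mod 3 = 1 then (real i, real k + real i) else (3 * real k + 1 - real i, real i))"
proof -
  let ?X = "\<lambda>i. (2 * real k + 1 - real i, 4 * real k + 1 - 2 * real i)"
  let ?Y = "\<lambda>i. (real i, real k + real i)"
  let ?Z = "\<lambda>i. (3 * real k + 1 - real i, real i)"
  show ?thesis
  proof (rule nested_triangles_cyclic)
    fix i assume "1 \<le> i" "i \<le> k"
    then show "orient (?X i) (?Y i) (?Z i) > 0"
      using corners_oriented[of "real i" "real k"] by (simp add: orient_def algebra_simps)
  next
    fix i j p assume i: "1 \<le> i" "i < j" "j \<le> k" and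
      p: "p \<in> {?X j, ?Y j, ?Z j}"
    define q where "q = (3 * real k + 1 - fst p, snd p)"
    \<comment> \<open>Reflection changes the sign of the determinant; exchanging the first two
      points restores it, so \<open>corners_inside\<close> applies to the mirror image
      \<open>q\<close>.\<close>
    have mirror: "orient (x, y) (x', y') p = orient (3 * real k + 1 - x', y') (3 * real k + 1 - x, y) q"
      for x y x' y'
      by (simp add: q_def orient_def algebra_simps)
    have "q \<in> {(real j, real j), (3 * real k + 1 - real j, real k + real j),
        (real k + real j, 4 * real k + 1 - 2 * real j)}"
      using p by (auto simp: q_def)
    from corners_inside[OF _ _ _ this, of "real i"] i
    show "orient (?X i) (?Y i) p > 0 \<and> orient (?Y i) (?Z i) p > 0 \<and> orient (?Z i) (?X i) p > 0"
      unfolding mirror by simp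
  next
    fix i assume i: "1 \<le> i" "i < k"
    then have r: "real i \<ge> 1" "real i + 1 \<le> real k" by simp_all
    show "orient (?Y (i + 1)) (?Z (i + 1)) (?Y i) < 0 \<and>
        orient (?Y (i + 1)) (?Z (i + 1)) (?Z i) < 0 \<and>
        orient (?Z (i + 1)) (?X (i + 1)) (?Z i) < 0 \<and>
        orient (?Z (i + 1)) (?X (i + 1)) (?X i) < 0"
      using r by (auto simp: orient_def algebra_simps)
    show "orient (?X (i + 1)) (?Y (i + 1)) (?X i) \<le> 0 \<and>
        orient (?X (i + 1)) (?Y (i + 1)) (?Y i) \<le> 0 \<and>
        (orient (?X (i + 1)) (?Y (i + 1)) (?X i) < 0 \<or>
        orient (?X (i + 1)) (?Y (i + 1)) (?Y i) < 0)"
      using r by (auto simp: orient_def algebra_simps)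
    show "orient (?X (i + 1)) (?Y (i + 1)) (?X i) < 0"
      using r by (simp add: orient_def algebra_simps)
    show "orient (?X (i + 1)) (?Y (i + 1)) (?Y i) < 0" if "D 0 i = Some False"
    proof -
      \<comment> \<open>As in the unreflected case, the determinant is
        \<open>i + 1 - k\<close>.\<close>
      have "i \<noteq> k - 1" using that assms by auto
      then have "real i + 2 \<le> real k" using i by linarith
      then show ?thesis using r by (simp add: orient_def algebra_simps)
    qed
  qed
qed

section \<open>From nested triangles to drawings of the graph\<close>

lemma nested_triangles_drawing:
  fixes p :: "ntvert \<Rightarrow> int \<times> int"
  assumes nested: "nested_triangles k D (\<lambda>c i. pt p (c mod 3, i))"
    and inj: "inj_on p (nt_vertices k)"
  shows "planar_sl_drawing (nt_vertices k) (nt_edges k D) p" "nested_embedding k p"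
proof -
  let ?V = "nt_vertices k" and ?E = "nt_edges k D"
  interpret nested_triangles k D "\<lambda>c i. pt p (c mod 3, i)" by (rule nested)
  have pt_inj: "inj_on (pt p) ?V"
  proof (rule inj_onI)
    fix a b assume "a \<in> ?V" "b \<in> ?V" "pt p a = pt p b"
    then show "a = b" using inj_onD[OF inj, of a b] by (simp add: pt_def prod_eq_iff)
  qed
  have edge: "e \<subseteq> ?V \<and> (\<exists>i x y. pt p ` e = {x, y} \<and> 1 \<le> i \<and> (side i x y \<and> i \<le> k \<or> link i x y \<and> i < k))"
    if "e \<in> ?E" for e
  proof -
    have thesisI: ?thesis if "pt p ` e = {x, y}" "e \<subseteq> ?V" "1 \<le> i" "side i x y \<and> i \<le> k \<or> link i x y \<and> i < k" for i x y
      using that by blast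
    consider (rim) c c' i where "e = {(c, i), (c', i)}" "c < 3" "c' < 3" "c \<noteq> c'" "1 \<le> i" "i \<le> k"
      | (spoke) c i where "e = {(c, i), (c, i + 1)}" "c < 3" "1 \<le> i" "i < k"
      | (rising) c i where "e = {(c, i), ((c + 1) mod 3, i + 1)}" "c < 3" "1 \<le> i" "i < k" "D c i = Some True"
      | (falling) c i where "e = {(c, i + 1), ((c + 1) mod 3, i)}" "c < 3" "1 \<le> i" "i < k" "D c i = Some False"
      using \<open>e \<in> ?E\<close> unfolding nt_edges_def by blast
    then show ?thesis
    proof cases
      case rim
      \<comment> \<open>Two distinct classes are cyclically consecutive in one of the two orders,
        which directs the unordered rim edge.\<close>
      have "c' = (c + 1) mod 3 \<or> c = (c' + 1) mod 3"
        using rim(2-4) mod3_cases[of c' c] mod3_step(3)[of c' c] by (metis mod_less)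
      then have "\<exists>d. e = {(d, i), ((d + 1) mod 3, i)} \<and> d < 3"
        using rim(1-3) by blast
      then obtain d where d: "e = {(d, i), ((d + 1) mod 3, i)}" "d < 3" by blast
      have "side i (pt p (d, i)) (pt p ((d + 1) mod 3, i))"
        unfolding side_def using d(2) by (intro exI[of _ d]) simp
      then show ?thesis using d(2) rim(5,6)
        by (intro thesisI[of "pt p (d, i)" "pt p ((d + 1) mod 3, i)" i]) (simp_all add: d(1) nt_vertices_def)
    next
      case spoke
      have "link i (pt p (c, i)) (pt p (c, i + 1))"
        unfolding link_def quad_link_def using spoke(2) by (intro exI[of _ c]) simp
      then show ?thesis using spoke(2-)
        by (intro thesisI[of "pt p (c, i)" "pt p (c, i + 1)" i]) (simp_all add: spoke(1) nt_vertices_def)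
    next
      case rising
      have "link i (pt p (c, i)) (pt p ((c + 1) mod 3, i + 1))"
        unfolding link_def quad_link_def using rising(2,5) by (intro exI[of _ c]) simp
      then show ?thesis using rising(2-)
        by (intro thesisI[of "pt p (c, i)" "pt p ((c + 1) mod 3, i + 1)" i])
          (simp_all add: rising(1) nt_vertices_def)
    next
      case falling
      \<comment> \<open>The graph lists a falling diagonal from its inner end, whereas
        \<open>link\<close> expects the outer end first.\<close>
      have "link i (pt p ((c + 1) mod 3, i)) (pt p (c, i + 1))"
        unfolding link_def quad_link_def using falling(2,5) by (intro exI[of _ c]) simp
      then show ?thesis using falling(2-)
        by (intro thesisI[of "pt p ((c + 1) mod 3, i)" "pt p (c, i + 1)" i])
          (simp_all add: falling(1) nt_vertices_def insert_commute)
    qed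
  qed
  have cross: "closed_segment (pt p a) (pt p b) \<inter> closed_segment (pt p a') (pt p b') \<subseteq> pt p ` ({a, b} \<inter> {a', b'})"
    if ab: "{a, b} \<in> ?E" "{a', b'} \<in> ?E" "{a, b} \<noteq> {a', b'}" for a b a' b'
  proof -
    obtain i x y where xy: "pt p ` {a, b} = {x, y}" "1 \<le> i" "side i x y \<and> i \<le> k \<or> link i x y \<and> i < k"
      using edge[OF ab(1)] by blast
    obtain j x' y' where xy': "pt p ` {a', b'} = {x', y'}" "1 \<le> j"
        "side j x' y' \<and> j \<le> k \<or> link j x' y' \<and> j < k"
      using edge[OF ab(2)] by blast
    have V: "{a, b} \<subseteq> ?V" "{a', b'} \<subseteq> ?V" using edge[OF ab(1)] edge[OF ab(2)] by blast+
    have "{x, y} \<noteq> {x', y'}"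
      using inj_on_image_eq_iff[OF pt_inj V] xy(1) xy'(1) ab(3) by metis
    then have meet: "meet_at_ends x y x' y'"
      using edge_edge xy xy' by blast
    have seg: "closed_segment (pt p a) (pt p b) = closed_segment x y"
        "closed_segment (pt p a') (pt p b') = closed_segment x' y'"
      using xy(1) xy'(1) by (simp_all add: segment_convex_hull)
    have "closed_segment (pt p a) (pt p b) \<inter> closed_segment (pt p a') (pt p b')
        \<subseteq> pt p ` {a, b} \<inter> pt p ` {a', b'}"
      using meet unfolding seg xy(1) xy'(1) meet_at_ends_def .
    also have "\<dots> = pt p ` ({a, b} \<inter> {a', b'})"
      using inj_on_image_Int[OF pt_inj V] by simp
    finally show ?thesis .
  qed
  have vertex: "c = a \<or> c = b"
    if ab: "{a, b} \<in> ?E" "c \<in> ?V" "pt p c \<in> closed_segment (pt p a) (pt p b)" for a b c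
  proof (rule ccontr)
    assume "\<not> (c = a \<or> c = b)"
    obtain d i where c: "c = (d, i)" "d < 3" "1 \<le> i" "i \<le> k"
      using ab(2) by (auto simp: nt_vertices_def)
    \<comment> \<open>A vertex on a foreign edge reduces to a crossing: \<open>c\<close> also lies
      on a rim edge of its own triangle, so \<open>cross\<close> makes it a common end of both
      edges.\<close>
    obtain d' :: nat where d': "d' < 3" "d' \<noteq> d" by (rule that[of "if d = 0 then 1 else 0"]) simp_all
    let ?c' = "(d', i)"
    have "{c, ?c'} \<in> ?E"
      unfolding nt_edges_def using c d' by blast
    moreover have "{a, b} \<noteq> {c, ?c'}" using \<open>\<not> (c = a \<or> c = b)\<close> by blast
    ultimately have "pt p c \<in> pt p ` ({a, b} \<inter> {c, ?c'})"
      using cross[OF ab(1)] ab(3) by fastforce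
    then have "pt p c \<in> pt p ` {a, b}" by blast
    moreover have "{a, b} \<subseteq> ?V" using edge[OF ab(1)] by blast
    ultimately have "c \<in> {a, b}" using inj_on_image_mem_iff[OF pt_inj ab(2)] by blast
    then show False using \<open>\<not> (c = a \<or> c = b)\<close> by simp
  qed
  show "planar_sl_drawing ?V ?E p"
    unfolding planar_sl_drawing_def using inj vertex cross by blast
  show "nested_embedding k p"
    unfolding nested_embedding_def
  proof (intro allI impI)
    fix i c :: nat assume i: "1 \<le> i \<and> i < k \<and> c < 3"
    have "orient (pt p (0, i)) (pt p (1, i)) (pt p (c, i + 1)) > 0"
      "orient (pt p (1, i)) (pt p (2, i)) (pt p (c, i + 1)) > 0"
      "orient (pt p (2, i)) (pt p (0, i)) (pt p (c, i + 1)) > 0"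
      using inside[of i "i + 1" 0 c] inside[of i "i + 1" 1 c] inside[of i "i + 1" 2 c] i
      by (simp_all add: numeral_2_eq_2)
    then show "pt p (c, i + 1) \<in> interior (convex hull {pt p (0, i), pt p (1, i), pt p (2, i)})"
      by (rule positive_orient_in_interior)
  qed
qed

section \<open>Choice of the drawing and grid bounds\<close>

theorem theorem5:
  fixes k :: nat and D :: "nat \<Rightarrow> nat \<Rightarrow> bool option"
  assumes "k \<ge> 1"
  shows "\<exists>p :: ntvert \<Rightarrow> int \<times> int.
           planar_sl_drawing (nt_vertices k) (nt_edges k D) p \<and>
           nested_embedding k p \<and>
           non_aligned (nt_vertices k) p \<and>
           in_grid (int (3 * k)) (4 * int (3 * k) div 3 - 1) (nt_vertices k) p"
proof -
  \<comment> \<open>Integer versions of the two placements. For \<open>k = 1\<close> the test reads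
    \<open>D 0 0\<close>, which belongs to no edge, and either placement is valid.\<close>
  define p :: "ntvert \<Rightarrow> int \<times> int" where "p = (\<lambda>(c, i).
    if D 0 (k - 1) = Some True then
      if c = 0 then (2 * int k + 1 - int i, 4 * int k + 1 - 2 * int i)
      else if c = 1 then (int i, int k + int i) else (3 * int k + 1 - int i, int i)
    else
      if c = 0 then (3 * int k + 1 - int i, int k + int i)
      else if c = 1 then (int k + int i, 4 * int k + 1 - 2 * int i) else (int i, int i))"
  have "nested_triangles k D (\<lambda>c i. pt p (c mod 3, i))"
  proof (cases "D 0 (k - 1) = Some True")
    case True
    have "(\<lambda>c i. pt p (c mod 3, i)) = (\<lambda>c i. if c mod 3 = 0 then (2 * real k + 1 - real i, 4 * real k + 1 - 2 * real i)
        else if c mod 3 = 1 then (real i, real k + real i) else (3 * real k + 1 - real i, real i))"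
      using True by (intro ext) (simp add: p_def pt_def)
    then show ?thesis using nested_mirrored[of D k, OF True] by simp
  next
    case False
    have "(\<lambda>c i. pt p (c mod 3, i)) = (\<lambda>c i. if c mod 3 = 0 then (3 * real k + 1 - real i, real k + real i)
        else if c mod 3 = 1 then (real k + real i, 4 * real k + 1 - 2 * real i) else (real i, real i))"
      using False by (intro ext) (simp add: p_def pt_def)
    then show ?thesis using nested_straight[of D k, OF False] by simp
  qed
  \<comment> \<open>In each coordinate the classes occupy disjoint ranges, and within a class the
    coordinate is strictly monotone in the level.\<close>
  moreover have "non_aligned (nt_vertices k) p"
    unfolding non_aligned_def nt_vertices_def p_def inj_on_def
    by (auto split: if_splits)
  moreover from this have "inj_on p (nt_vertices k)"
    unfolding non_aligned_def by (metis (mono_tags, lifting) inj_on_def)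
  moreover have "4 * int (3 * k) div 3 = 4 * int k" by simp
  then have "in_grid (int (3 * k)) (4 * int (3 * k) div 3 - 1) (nt_vertices k) p"
    unfolding in_grid_def nt_vertices_def p_def by auto
  ultimately show ?thesis using nested_triangles_drawing by blast
qed

end
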